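(* Suppose $G$ is a digraph not containing a copy of $\overrightarrow{K}_{m,n}$ for some $m$ and $n$. Then the complex $\overrightarrow{\mathcal{N}}(G)$ admits a strong deformation retract onto a complex of dimension at most $m+n-3$.
   Context: A digraph $G$ consists of a finite vertex set $V(G)$ and an edge set $E(G)\subseteq V(G)\times V(G)$ (loops $(v,v)$ are allowed, and $(v,w)$ and $(w,v)$ may both be edges). For $v\in V(G)$ put $\overrightarrow{N}_G(v)=\{w\in V(G):(v,w)\in E(G)\}$. The out-neighborhood complex $\overrightarrow{\mathcal{N}}(G)$ is the simplicial complex on vertex set $\{v\in V(G):\mathrm{indeg}(v)>0\}$ with facets given by the out-neighborhoods $\overrightarrow{N}_G(v)$ for all $v\in V(G)$ (that is, a nonempty set of vertices is a face iff it is contained in some $\overrightarrow{N}_G(v)$). For integers $m,n$, the complete bipartite digraph $\overrightarrow{K}_{m,n}$ is the directed graph on vertex set $\{a_1,\dots,a_m,b_1,\dots,b_n\}$ with edge set $\{(a_i,b_j): i\in\{1,\dots,m\},\ j\in\{1,\dots,n\}\}$. A copy of $\overrightarrow{K}_{m,n}$ in $G$ is a subgraph of $G$ isomorphic to $\overrightarrow{K}_{m,n}$.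
   Formalization: Takes m,n ≥ 1 and adds that no vertex sets A, B with |A|=m, |B|=n that overlap have all edges A×B in G (automatic without loops); otherwise false: the 3-cycle with loops has no copy of K_{1,2}, but its complex is a circle. *)

theory Defs
  imports
    "HOL-Analysis.Analysis"
    "Graph_Theory.Pair_Digraph"
    "Graph_Theory.Digraph_Component"
    "Graph_Theory.Digraph_Isomorphism"
begin

section \<open>Abstract simplicial complexes\<close>

text \<open>
  A complex is the set of its nonempty faces; its vertices are the elements of
  \<open>\<Union>K\<close>. The empty complex is allowed and has dimension \<open>-1\<close>.
\<close>

definition abstract_complex :: "'v set set \<Rightarrow> bool" where
  "abstract_complex K \<longleftrightarrow>
     (\<forall>\<sigma>\<in>K. finite \<sigma> \<and> \<sigma> \<noteq> {}) \<and> (\<forall>\<sigma>\<in>K. \<forall>\<tau>. \<tau> \<subseteq> \<sigma> \<and> \<tau> \<noteq> {} \<longrightarrow> \<tau> \<in> K)"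

text \<open>Only meaningful for finite \<open>K\<close>.\<close>

definition complex_dim :: "'v set set \<Rightarrow> int" where
  "complex_dim K = Max (insert (-1) ((\<lambda>\<sigma>. int (card \<sigma>) - 1) ` K))"

text \<open>
  Barycentric coordinates with the topology inherited from the product topology.
  For a finite complex this is the usual (weak) topology.
\<close>

definition realization :: "'v set set \<Rightarrow> ('v \<Rightarrow> real) topology" where
  "realization K = subtopology (powertop_real UNIV)
     {x. (\<forall>v. 0 \<le> x v) \<and> {v. x v \<noteq> 0} \<in> K \<and> (\<Sum>v | x v \<noteq> 0. x v) = 1}"

text \<open>The homotopy from the identity to the retraction keeps \<open>S\<close> pointwise fixed at all times.\<close>

definition strong_deformation_retract_of_space :: "'a set \<Rightarrow> 'a topology \<Rightarrow> bool"
    (infix \<open>strong'_deformation'_retract'_of'_space\<close> 50) where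
  "S strong_deformation_retract_of_space X \<longleftrightarrow>
     S \<subseteq> topspace X \<and>
     (\<exists>r. continuous_map X (subtopology X S) r \<and> (\<forall>x\<in>S. r x = x) \<and>
          homotopic_with (\<lambda>h. \<forall>x\<in>S. h x = x) X X id r)"


section \<open>Digraphs\<close>

definition out_neighborhood :: "'a pair_pre_digraph \<Rightarrow> 'a \<Rightarrow> 'a set" where
  "out_neighborhood G v = {w \<in> pverts G. (v, w) \<in> parcs G}"

definition out_neighborhood_complex :: "'a pair_pre_digraph \<Rightarrow> 'a set set" where
  "out_neighborhood_complex G =
     {\<sigma>. \<sigma> \<noteq> {} \<and> (\<exists>v\<in>pverts G. \<sigma> \<subseteq> out_neighborhood G v)}"

lemma (in pair_fin_digraph) abstract_complex_out_neighborhood_complex: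
  "abstract_complex (out_neighborhood_complex G)"
proof -
  have "finite (out_neighborhood G v)" for v
    using pair_finite_verts by (simp add: out_neighborhood_def)
  then show ?thesis
    unfolding abstract_complex_def out_neighborhood_complex_def
    by (safe; meson finite_subset subset_trans)
qed

lemma (in pair_fin_digraph) vertices_out_neighborhood_complex:
  "\<Union>(out_neighborhood_complex G) = {v \<in> pverts G. in_degree (with_proj G) v > 0}"
proof -
  have "in_degree (with_proj G) w > 0 \<longleftrightarrow> (\<exists>u. (u, w) \<in> parcs G)" for w
    using pair_finite_arcs by (auto simp: in_degree_def in_arcs_def card_gt_0_iff)
  moreover have "w \<in> \<Union>(out_neighborhood_complex G) \<longleftrightarrow> (\<exists>u. (u, w) \<in> parcs G)" for w
  proof
    assume "\<exists>u. (u, w) \<in> parcs G"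
    then obtain u where "(u, w) \<in> parcs G" ..
    then have "{w} \<in> out_neighborhood_complex G"
      using in_arcsD1 in_arcsD2
      by (auto simp: out_neighborhood_complex_def out_neighborhood_def)
    then show "w \<in> \<Union>(out_neighborhood_complex G)" by blast
  qed (auto simp: out_neighborhood_complex_def out_neighborhood_def)
  ultimately show ?thesis using in_arcsD2 by blast
qed

definition complete_bipartite_digraph :: "nat \<Rightarrow> nat \<Rightarrow> (nat + nat) pair_pre_digraph" where
  "complete_bipartite_digraph m n =
     \<lparr> pverts = Inl ` {1..m} \<union> Inr ` {1..n},
       parcs = {(Inl i, Inr j) |i j. i \<in> {1..m} \<and> j \<in> {1..n}} \<rparr>"

definition contains_copy :: "'a pair_pre_digraph \<Rightarrow> 'b pair_pre_digraph \<Rightarrow> bool" where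
  "contains_copy G K \<longleftrightarrow>
     (\<exists>H :: 'a pair_pre_digraph.
        subgraph (with_proj H) (with_proj G) \<and> digraph_iso (with_proj K) (with_proj H))"

text \<open>
  In a copy of \<open>complete_bipartite_digraph m n\<close> the two parts are disjoint. A digraph
  with loops may also contain a full product \<open>A \<times> B\<close> of edges between overlapping sets;
  this is not a copy. For instance, the vertices \<open>0, 1, 2\<close> with edges \<open>(i, i)\<close> and
  \<open>(i, i + 1 mod 3)\<close> contain no copy for \<open>m = 1\<close>, \<open>n = 2\<close>, although the
  out-neighborhood complex is a circle. Overlapping products therefore have to be
  excluded separately; without loops there are none.
\<close>

definition no_overlapping_product :: "nat \<Rightarrow> nat \<Rightarrow> 'a pair_pre_digraph \<Rightarrow> bool" where
  "no_overlapping_product m n G \<longleftrightarrow>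
     (\<forall>A B. A \<subseteq> pverts G \<and> B \<subseteq> pverts G \<and> card A = m \<and> card B = n \<and>
            A \<times> B \<subseteq> parcs G \<longrightarrow> A \<inter> B = {})"

lemma (in pair_loopfree_digraph) no_overlapping_product_loopfree:
  "no_overlapping_product m n G"
  unfolding no_overlapping_product_def using pair_no_loops by fastforce

end

theory Submission
  imports Defs
begin

text \<open>
  The maximal out-neighborhoods are the facets of the complex; below, every out-neighborhood
  is called a facet. The retract is a copy of the order complex of the poset of nonempty
  intersections of facets, and the bound on its dimension is a bound on the length of chains
  in this poset.

  For the retraction, write \<open>cl \<sigma>\<close> for the intersection of all facets that contain the face
  \<open>\<sigma>\<close>. On the barycentric subdivision, the retraction sends the barycenter of \<open>\<sigma>\<close> to that of
  \<open>cl \<sigma>\<close>. To avoid subdivisions, the same idea is expressed by level sets: a point \<open>x\<close> is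
  determined by its superlevel sets \<open>{v. t \<le> x v}\<close>, \<open>t > 0\<close>, and replacing each of them by its
  closure gives a function \<open>saturation F x\<close>, which is a minimum of maxima of coordinates and
  hence continuous. Dividing by the sum of the coordinates gives a retraction of the complex
  onto the points all of whose nonempty superlevel sets are intersections of facets. If the support of
  \<open>x\<close> lies in a facet, then so does the support of the image of \<open>x\<close>, so the straight-line
  homotopy stays inside the complex, and it does not move the points that the retraction
  fixes (\<open>saturated_points_strong_deformation_retract\<close>). The superlevel sets of a fixed point
  form a chain of intersections of facets, and writing the point as a nonnegative combination
  of their indicator functions identifies the set of fixed points with the order complex
  (\<open>order_complex_realization_homeomorphic\<close>).

  For the dimension, note that a strictly larger intersection of out-neighborhoods has strictly
  fewer common in-neighbors. Along a chain, the members with fewer than \<open>n\<close> elements are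
  told apart by their size, so there are at most \<open>n - 1\<close> of them. Each other member has fewer
  than \<open>m\<close> common in-neighbors, and these members are told apart by that number, so there are
  at most \<open>m - 1\<close> of them. A chain thus has at most \<open>m + n - 2\<close> members
  (\<open>card_chain_facet_intersections\<close>).
\<close>


section \<open>Intersections of facets\<close>

definition facet_complex :: "'a set set \<Rightarrow> 'a set set" where
  "facet_complex F = {\<sigma>. \<sigma> \<noteq> {} \<and> (\<exists>S\<in>F. \<sigma> \<subseteq> S)}"

definition facet_intersections :: "'a set set \<Rightarrow> 'a set set" where
  "facet_intersections F = {\<Inter>\<S> | \<S>. \<S> \<subseteq> F \<and> \<S> \<noteq> {}} - {{}}"

lemma facet_intersections_nonempty: "B \<in> facet_intersections F \<Longrightarrow> B \<noteq> {}"
  by (simp add: facet_intersections_def)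

text \<open>
  The right-hand side says that \<open>B\<close> is a closed face: it equals the intersection of all facets
  that contain it.
\<close>

lemma facet_intersections_iff:
  "B \<in> facet_intersections F \<longleftrightarrow> B \<in> facet_complex F \<and> (\<forall>v. v \<notin> B \<longrightarrow> (\<exists>S\<in>F. B \<subseteq> S \<and> v \<notin> S))"
  (is "_ \<longleftrightarrow> ?rhs")
proof
  assume "B \<in> facet_intersections F"
  then show ?rhs
    by (fastforce simp: facet_intersections_def facet_complex_def)
next
  assume r: ?rhs
  then have "B = \<Inter>{S \<in> F. B \<subseteq> S}" "{S \<in> F. B \<subseteq> S} \<noteq> {}" "B \<noteq> {}"
    by (auto simp: facet_complex_def)
  then show "B \<in> facet_intersections F"
    unfolding facet_intersections_def by blast
qed

lemma facet_intersections_separate: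
  assumes "B \<in> facet_intersections F" "v \<notin> B"
  obtains S where "S \<in> F" "B \<subseteq> S" "v \<notin> S"
  using assms by (auto simp: facet_intersections_iff)

lemma facet_intersections_subset: "facet_intersections F \<subseteq> facet_complex F"
  using facet_intersections_iff by blast

lemma facet_complex_subset_Pow: "facet_complex F \<subseteq> Pow (\<Union>F)"
  by (auto simp: facet_complex_def)

lemma finite_facet_intersections: "finite (\<Union>F) \<Longrightarrow> finite (facet_intersections F)"
  by (meson facet_complex_subset_Pow facet_intersections_subset finite_Pow_iff finite_subset)

lemma finite_mem_facet_intersections:
  "finite (\<Union>F) \<Longrightarrow> B \<in> facet_intersections F \<Longrightarrow> finite B"
  by (meson facet_complex_subset_Pow facet_intersections_subset PowD finite_subset subsetD)

text \<open>
  The union of a nonempty finite chain is one of its members. Hence the members of a chain that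
  fail to contain \<open>B\<close> leave some point of \<open>B\<close> uncovered.
\<close>

lemma Union_chain_subset:
  assumes "finite C" "subset.chain P C" "\<And>D. D \<in> C \<Longrightarrow> \<not> B \<subseteq> D" "B \<noteq> {}"
  shows "\<not> B \<subseteq> \<Union>C"
  using assms Union_in_chain by (cases "C = {}") auto


section \<open>Points of the realization\<close>

definition points :: "'v set set \<Rightarrow> ('v \<Rightarrow> real) set" where
  "points K = {x. (\<forall>v. 0 \<le> x v) \<and> {v. x v \<noteq> 0} \<in> K \<and> (\<Sum>v | x v \<noteq> 0. x v) = 1}"

lemma realization_eq_top_of_set: "realization K = top_of_set (points K)"
  by (simp add: realization_def points_def euclidean_product_topology)

lemma sum_support:
  fixes x :: "'a \<Rightarrow> real"
  assumes "finite V" "{v. x v \<noteq> 0} \<subseteq> V"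
  shows "(\<Sum>v | x v \<noteq> 0. x v) = sum x V"
  using assms by (intro sum.mono_neutral_left) auto

lemma points_facet_complex_iff:
  assumes "finite (\<Union>F)"
  shows "x \<in> points (facet_complex F) \<longleftrightarrow>
     (\<forall>v. 0 \<le> x v) \<and> (\<exists>S\<in>F. {v. x v \<noteq> 0} \<subseteq> S) \<and> sum x (\<Union>F) = 1"
proof -
  have "(\<Sum>v | x v \<noteq> 0. x v) = sum x (\<Union>F)" if "S \<in> F" "{v. x v \<noteq> 0} \<subseteq> S" for S
    using that by (intro sum_support[OF assms]) auto
  moreover have "{v. x v \<noteq> 0} \<noteq> {}" if "sum x (\<Union>F) = 1"
    using that by (metis (mono_tags, lifting) empty_Collect_eq sum.not_neutral_contains_not_neutral zero_neq_one)
  ultimately show ?thesis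
    by (auto simp: points_def facet_complex_def)
qed

lemma points_facet_complex_convex:
  assumes "finite (\<Union>F)" "x \<in> points (facet_complex F)" "y \<in> points (facet_complex F)"
    and "\<And>S. S \<in> F \<Longrightarrow> {v. x v \<noteq> 0} \<subseteq> S \<Longrightarrow> {v. y v \<noteq> 0} \<subseteq> S"
    and "t \<in> {0..1}"
  shows "(\<lambda>v. (1 - t) * x v + t * y v) \<in> points (facet_complex F)"
proof -
  obtain S where S: "S \<in> F" "{v. x v \<noteq> 0} \<subseteq> S" "{v. y v \<noteq> 0} \<subseteq> S"
    using assms by (auto simp: points_facet_complex_iff)
  have "{v. (1 - t) * x v + t * y v \<noteq> 0} \<subseteq> {v. x v \<noteq> 0} \<union> {v. y v \<noteq> 0}" by auto
  also have "\<dots> \<subseteq> S" using S(2,3) by simp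
  finally have "{v. (1 - t) * x v + t * y v \<noteq> 0} \<subseteq> S" .
  moreover have "(\<Sum>v\<in>\<Union>F. (1 - t) * x v + t * y v) = 1"
    using assms by (simp add: sum.distrib points_facet_complex_iff flip: sum_distrib_left)
  ultimately show ?thesis
    using assms S(1) by (auto simp: points_facet_complex_iff)
qed


section \<open>Saturation\<close>

text \<open>
  The value at \<open>v\<close> is the largest \<open>t\<close> for which \<open>v\<close> lies in the closure of the superlevel set
  \<open>{w. t \<le> x w}\<close>: this closure misses \<open>v\<close> iff some facet \<open>S\<close> without \<open>v\<close> contains the
  superlevel set, that is, iff all \<open>w\<close> outside some such \<open>S\<close> have \<open>x w < t\<close>. The empty set
  among the candidates for \<open>S\<close> gives the closure of the empty superlevel set, and it keeps the
  minimum over a nonempty set when \<open>v\<close> lies in every facet.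
\<close>

definition saturation :: "'a set set \<Rightarrow> ('a \<Rightarrow> real) \<Rightarrow> 'a \<Rightarrow> real" where
  "saturation F x v =
     (if v \<in> \<Union>F
      then Min ((\<lambda>S. Max (x ` (\<Union>F - S))) ` {S \<in> insert {} F. v \<notin> S}) else 0)"

lemma le_saturation_iff:
  assumes "finite (\<Union>F)" "v \<in> \<Union>F"
  shows "t \<le> saturation F x v \<longleftrightarrow> (\<forall>S\<in>insert {} F. v \<notin> S \<longrightarrow> (\<exists>w\<in>\<Union>F - S. t \<le> x w))"
proof -
  have "finite F" using assms(1) by (rule finite_UnionD)
  have "t \<le> saturation F x v \<longleftrightarrow> (\<forall>S\<in>{S \<in> insert {} F. v \<notin> S}. t \<le> Max (x ` (\<Union>F - S)))"
    unfolding saturation_def if_P[OF assms(2)]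
    using assms(2) \<open>finite F\<close> by (subst Min_ge_iff) auto
  also have "\<dots> \<longleftrightarrow> (\<forall>S\<in>{S \<in> insert {} F. v \<notin> S}. \<exists>w\<in>\<Union>F - S. t \<le> x w)"
  proof (rule ball_cong[OF refl])
    fix S assume "S \<in> {S \<in> insert {} F. v \<notin> S}"
    then have "v \<in> \<Union>F - S" using assms(2) by auto
    then show "(t \<le> Max (x ` (\<Union>F - S))) = (\<exists>w\<in>\<Union>F - S. t \<le> x w)"
      using assms(1) by (subst Max_ge_iff) auto
  qed
  finally show ?thesis by auto
qed

lemma saturation_witness:
  assumes "finite (\<Union>F)" "v \<in> \<Union>F" "S \<in> insert {} F" "v \<notin> S"
  obtains w where "w \<in> \<Union>F - S" "saturation F x v \<le> x w"
proof -
  have "v \<notin> S \<longrightarrow> (\<exists>w\<in>\<Union>F - S. saturation F x v \<le> x w)"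
    using iffD1[OF le_saturation_iff[OF assms(1,2)] order_refl] assms(3) by (rule bspec)
  with assms(4) that show thesis by blast
qed

lemma le_saturation:
  assumes "finite (\<Union>F)" "v \<in> \<Union>F" shows "x v \<le> saturation F x v"
  using assms by (auto simp: le_saturation_iff)

lemma saturation_nonneg:
  assumes "finite (\<Union>F)" "\<And>v. 0 \<le> x v" shows "0 \<le> saturation F x v"
proof (cases "v \<in> \<Union>F")
  case True
  then show ?thesis using le_saturation[OF assms(1) True, of x] assms(2)[of v] by linarith
qed (simp add: saturation_def)

text \<open>
  Every facet that contains the support of \<open>x\<close> also contains its closure.
\<close>

lemma saturation_support:
  assumes "finite (\<Union>F)" "\<And>v. 0 \<le> x v" "S \<in> F" "{v. x v \<noteq> 0} \<subseteq> S"
  shows "{v. saturation F x v \<noteq> 0} \<subseteq> S"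
proof safe
  fix v assume v: "saturation F x v \<noteq> 0"
  then have "v \<in> \<Union>F" by (metis saturation_def)
  show "v \<in> S"
  proof (rule ccontr)
    assume "v \<notin> S"
    then obtain w where "w \<in> \<Union>F - S" "saturation F x v \<le> x w"
      using saturation_witness[OF assms(1) \<open>v \<in> \<Union>F\<close> insertI2[OF assms(3)]] by metis
    moreover have "x w = 0" using assms(4) \<open>w \<in> \<Union>F - S\<close> by auto
    moreover have "0 \<le> saturation F x v" using assms(1,2) by (rule saturation_nonneg)
    ultimately show False using v by auto
  qed
qed

text \<open>
  Follows from idempotence of the closure: a witness \<open>w\<close> outside \<open>S\<close> for the saturated function
  has itself a witness outside \<open>S\<close> for the original one.
\<close>

lemma saturation_idem:
  assumes "finite (\<Union>F)"
  shows "saturation F (saturation F x) = saturation F x"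
proof
  fix v
  show "saturation F (saturation F x) v = saturation F x v"
  proof (cases "v \<in> \<Union>F")
    case True
    have "saturation F (saturation F x) v \<le> saturation F x v"
      unfolding le_saturation_iff[OF assms True]
    proof (intro ballI impI)
      fix S assume S: "S \<in> insert {} F" "v \<notin> S"
      obtain w where w: "w \<in> \<Union>F - S" "saturation F (saturation F x) v \<le> saturation F x w"
        by (rule saturation_witness[OF assms True S])
      have "w \<in> \<Union>F" "w \<notin> S" using w(1) by auto
      then obtain u where u: "u \<in> \<Union>F - S" "saturation F x w \<le> x u"
        using saturation_witness[OF assms _ S(1)] by metis
      show "\<exists>w\<in>\<Union>F - S. saturation F (saturation F x) v \<le> x w"
        using u(1) order_trans[OF w(2) u(2)] by (rule bexI[rotated])
    qed
    then show ?thesis using le_saturation[OF assms True] by (simp add: antisym)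
  qed (simp add: saturation_def)
qed

lemma saturation_scale:
  assumes "finite (\<Union>F)" "0 < a"
  shows "saturation F (\<lambda>v. x v / a) v = saturation F x v / a"
proof (cases "v \<in> \<Union>F")
  case True
  have "t \<le> saturation F (\<lambda>v. x v / a) v \<longleftrightarrow> t \<le> saturation F x v / a" for t
    using assms(2) by (simp add: le_saturation_iff[OF assms(1) True] pos_le_divide_eq)
  then show ?thesis by (meson antisym order_refl)
qed (simp add: saturation_def)

lemma continuous_on_Max_image:
  fixes f :: "'i \<Rightarrow> 'b::topological_space \<Rightarrow> real"
  assumes "finite I" "I \<noteq> {}" "\<And>i. i \<in> I \<Longrightarrow> continuous_on A (f i)"
  shows "continuous_on A (\<lambda>x. Max ((\<lambda>i. f i x) ` I))"
  using assms
proof (induction I rule: finite_ne_induct)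
  case (insert i I)
  then have "continuous_on A (\<lambda>x. max (f i x) (Max ((\<lambda>i. f i x) ` I)))"
    by (intro continuous_on_max) auto
  then show ?case using insert by simp
qed simp

lemma continuous_on_Min_image:
  fixes f :: "'i \<Rightarrow> 'b::topological_space \<Rightarrow> real"
  assumes "finite I" "I \<noteq> {}" "\<And>i. i \<in> I \<Longrightarrow> continuous_on A (f i)"
  shows "continuous_on A (\<lambda>x. Min ((\<lambda>i. f i x) ` I))"
  using assms
proof (induction I rule: finite_ne_induct)
  case (insert i I)
  then have "continuous_on A (\<lambda>x. min (f i x) (Min ((\<lambda>i. f i x) ` I)))"
    by (intro continuous_on_min) auto
  then show ?case using insert by simp
qed simp

lemma continuous_on_saturation:
  assumes "finite (\<Union>F)"
  shows "continuous_on A (\<lambda>x. saturation F x v)"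
proof (cases "v \<in> \<Union>F")
  case True
  have "finite F" using assms by (rule finite_UnionD)
  have "continuous_on A (\<lambda>x. Max ((\<lambda>w. x w) ` (\<Union>F - S)))" if "v \<notin> S" for S
    using that assms True by (intro continuous_on_Max_image continuous_on_subset[OF continuous_on_product_coordinates]) auto
  then have "continuous_on A (\<lambda>x. Min ((\<lambda>S. Max ((\<lambda>w. x w) ` (\<Union>F - S))) ` {S \<in> insert {} F. v \<notin> S}))"
    using \<open>finite F\<close> by (intro continuous_on_Min_image) auto
  then show ?thesis using True by (simp add: saturation_def)
qed (simp add: saturation_def)

definition saturated_points :: "'a set set \<Rightarrow> ('a \<Rightarrow> real) set" where
  "saturated_points F = {x \<in> points (facet_complex F). saturation F x = x}"

text \<open>
  Saturation raises coordinates, so the result has to be rescaled to coordinate sum \<open>1\<close>. As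
  saturation is idempotent and commutes with positive scaling, the rescaled function is still
  saturated.
\<close>

definition saturating_retraction :: "'a set set \<Rightarrow> ('a \<Rightarrow> real) \<Rightarrow> 'a \<Rightarrow> real" where
  "saturating_retraction F x v = saturation F x v / sum (saturation F x) (\<Union>F)"

lemma sum_saturation_ge_1:
  assumes "finite (\<Union>F)" "x \<in> points (facet_complex F)"
  shows "1 \<le> sum (saturation F x) (\<Union>F)"
proof -
  have "sum x (\<Union>F) \<le> sum (saturation F x) (\<Union>F)"
    using le_saturation[OF assms(1)] by (intro sum_mono)
  then show ?thesis using assms by (simp add: points_facet_complex_iff)
qed

lemma saturating_retraction_in_points:
  assumes "finite (\<Union>F)" "x \<in> points (facet_complex F)"
  shows "saturating_retraction F x \<in> points (facet_complex F)"
proof -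
  obtain S where S: "S \<in> F" "{v. x v \<noteq> 0} \<subseteq> S" and nn: "\<And>v. 0 \<le> x v"
    using assms by (auto simp: points_facet_complex_iff)
  have "{v. saturation F x v \<noteq> 0} \<subseteq> S" using assms(1) nn S by (rule saturation_support)
  moreover have "sum (saturating_retraction F x) (\<Union>F) = 1"
    using sum_saturation_ge_1[OF assms] unfolding saturating_retraction_def
    by (simp flip: sum_divide_distrib)
  ultimately show ?thesis
    using S(1) saturation_nonneg[OF assms(1) nn] sum_saturation_ge_1[OF assms]
    unfolding points_facet_complex_iff[OF assms(1)]
    by (auto simp: saturating_retraction_def)
qed

lemma saturating_retraction_in_saturated_points:
  assumes "finite (\<Union>F)" "x \<in> points (facet_complex F)"
  shows "saturating_retraction F x \<in> saturated_points F"
proof -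
  have "saturation F (saturating_retraction F x) = saturating_retraction F x"
    using sum_saturation_ge_1[OF assms]
    by (auto simp: saturating_retraction_def[abs_def] saturation_scale[OF assms(1)] saturation_idem[OF assms(1)])
  then show ?thesis
    using saturating_retraction_in_points[OF assms] by (simp add: saturated_points_def)
qed

lemma saturating_retraction_fixes:
  assumes "finite (\<Union>F)" "x \<in> saturated_points F"
  shows "saturating_retraction F x = x"
  using assms by (auto simp: saturated_points_def saturating_retraction_def points_facet_complex_iff)

lemma continuous_on_saturating_retraction:
  assumes "finite (\<Union>F)"
  shows "continuous_on (points (facet_complex F)) (\<lambda>x. saturating_retraction F x v)"
  unfolding saturating_retraction_def
  using sum_saturation_ge_1[OF assms]
  by (intro continuous_on_divide continuous_on_sum continuous_on_saturation assms) force

proposition saturated_points_strong_deformation_retract: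
  assumes fin: "finite (\<Union>F)"
  shows "saturated_points F strong_deformation_retract_of_space realization (facet_complex F)"
proof -
  define r where "r = saturating_retraction F"
  define X where "X = points (facet_complex F)"
  define h where "h = (\<lambda>(t, x) v. (1 - t) * x v + t * r x v :: real)"
  have R: "saturated_points F \<subseteq> X" by (auto simp: saturated_points_def X_def)
  have r_cont: "continuous_on X (\<lambda>x. r x v)" for v
    unfolding r_def X_def by (rule continuous_on_saturating_retraction[OF fin])
  have r_mem: "r x \<in> saturated_points F" if "x \<in> X" for x
    using that saturating_retraction_in_saturated_points[OF fin] by (simp add: X_def r_def)
  have r_supp: "{v. r x v \<noteq> 0} \<subseteq> S" if "x \<in> X" "S \<in> F" "{v. x v \<noteq> 0} \<subseteq> S" for x S
  proof -
    have "{v. r x v \<noteq> 0} \<subseteq> {v. saturation F x v \<noteq> 0}" by (auto simp: r_def saturating_retraction_def)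
    also have "\<dots> \<subseteq> S"
      using that saturation_support[OF fin, of x S] by (simp add: X_def points_facet_complex_iff[OF fin])
    finally show ?thesis .
  qed
  \<comment> \<open>A facet that contains the support of \<open>x\<close> contains the whole segment from \<open>x\<close> to \<open>r x\<close>.\<close>
  have h_mem: "h (t, x) \<in> X" if "t \<in> {0..1}" "x \<in> X" for t x
    unfolding h_def prod.case X_def
    using that r_mem[OF that(2)] r_supp[OF that(2)] R
    by (intro points_facet_complex_convex[OF fin]) (auto simp: X_def)
  have "continuous_on ({0..1} \<times> X) (\<lambda>p. h p v)" for v
  proof -
    have "continuous_on ({0..1} \<times> X) (\<lambda>p. r (snd p) v)"
      by (rule continuous_on_compose2[OF r_cont]) (auto intro: continuous_intros)
    moreover have "continuous_on ({0..1} \<times> X) (\<lambda>p. snd p v)"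
      by (rule continuous_on_compose2[OF continuous_on_product_coordinates[of v]])
        (auto intro: continuous_intros)
    ultimately show ?thesis
      unfolding h_def case_prod_beta by (intro continuous_intros)
  qed
  then have h_cont: "continuous_on ({0..1} \<times> X) h"
    by (intro continuous_on_coordinatewise_then_product)
  have fixes_R: "\<forall>x\<in>saturated_points F. r x = x"
    using saturating_retraction_fixes[OF fin] by (simp add: r_def)
  have "homotopic_with (\<lambda>k. \<forall>x\<in>saturated_points F. k x = x) (top_of_set X) (top_of_set X) id r"
    unfolding homotopic_with_def
  proof (intro exI conjI)
    show "continuous_map (prod_topology (top_of_set {0..1}) (top_of_set X)) (top_of_set X) h"
      using h_cont h_mem by auto
  qed (use fixes_R in \<open>auto simp: h_def fun_eq_iff algebra_simps\<close>)
  moreover have "continuous_map (top_of_set X) (top_of_set (saturated_points F)) r"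
    using r_mem r_cont by (auto intro: continuous_on_coordinatewise_then_product)
  moreover have "subtopology (top_of_set X) (saturated_points F) = top_of_set (saturated_points F)"
    using R by (simp add: subtopology_subtopology inf_absorb2)
  ultimately show ?thesis
    using R fixes_R unfolding strong_deformation_retract_of_space_def realization_eq_top_of_set
    by (auto simp flip: X_def)
qed

section \<open>Combinations of indicator functions of chains\<close>

text \<open>
  The function \<open>\<Sum>B\<in>P. c B \<cdot> 1\<^sub>B\<close>. When \<open>c\<close> is nonnegative and supported on a chain, this is the
  decomposition of a function into its superlevel sets.
\<close>

definition layer_sum :: "'a set set \<Rightarrow> ('a set \<Rightarrow> real) \<Rightarrow> 'a \<Rightarrow> real" where
  "layer_sum P c v = (\<Sum>B | B \<in> P \<and> v \<in> B. c B)"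

lemma layer_sum_nonneg:
  assumes "\<And>B. B \<in> P \<Longrightarrow> 0 \<le> c B"
  shows "0 \<le> layer_sum P c v"
  using assms by (auto simp: layer_sum_def intro: sum_nonneg)

lemma layer_sum_support:
  assumes "finite P" "\<And>B. B \<in> P \<Longrightarrow> 0 \<le> c B"
  shows "{v. layer_sum P c v \<noteq> 0} = \<Union>{B \<in> P. c B \<noteq> 0}"
proof -
  have "layer_sum P c v = 0 \<longleftrightarrow> (\<forall>B\<in>{B \<in> P. v \<in> B}. c B = 0)" for v
    unfolding layer_sum_def using assms by (intro sum_nonneg_eq_0_iff) auto
  then show ?thesis by auto
qed

text \<open>
  Choose a point \<open>v\<close> of \<open>B\<close> outside all sets of the chain that do not contain \<open>B\<close>. At \<open>v\<close> the
  first sum has no terms but those of the sets containing \<open>B\<close>, whereas the second sum has at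
  least these terms. The terms above \<open>B\<close> cancel.
\<close>

lemma layer_coefficient_le:
  assumes P: "finite P"
    and c: "\<And>D. D \<in> P \<Longrightarrow> 0 \<le> c D" "subset.chain P {D \<in> P. c D \<noteq> 0}"
    and c': "\<And>D. D \<in> P \<Longrightarrow> 0 \<le> c' D"
    and eq: "layer_sum P c = layer_sum P c'"
    and B: "B \<in> P" "B \<noteq> {}" and above: "\<And>D. D \<in> P \<Longrightarrow> B \<subset> D \<Longrightarrow> c D = c' D"
  shows "c' B \<le> c B"
proof -
  define U where "U = {D \<in> P. c D \<noteq> 0 \<and> \<not> B \<subseteq> D}"
  have "subset.chain P U" using c(2) by (auto simp: U_def subset_chain_def)
  then have "\<not> B \<subseteq> \<Union>U" using P B by (intro Union_chain_subset) (auto simp: U_def)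
  then obtain v where v: "v \<in> B" "v \<notin> \<Union>U" by blast
  have split: "{D. D \<in> P \<and> B \<subseteq> D} = insert B {D. D \<in> P \<and> B \<subset> D}" using B by auto
  have up: "(\<Sum>D | D \<in> P \<and> B \<subseteq> D. d D) = d B + (\<Sum>D | D \<in> P \<and> B \<subset> D. d D)" for d :: "_ \<Rightarrow> real"
    unfolding split using P by (subst sum.insert) auto
  have "c' B + (\<Sum>D | D \<in> P \<and> B \<subset> D. c' D) = (\<Sum>D | D \<in> P \<and> B \<subseteq> D. c' D)" by (rule up[symmetric])
  also have "\<dots> \<le> layer_sum P c' v"
    unfolding layer_sum_def using P c' v(1) by (intro sum_mono2) auto
  also have "\<dots> = layer_sum P c v" by (simp add: eq)
  also have "\<dots> = (\<Sum>D | D \<in> P \<and> B \<subseteq> D. c D)"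
    unfolding layer_sum_def using P v by (intro sum.mono_neutral_right) (auto simp: U_def)
  also have "\<dots> = c B + (\<Sum>D | D \<in> P \<and> B \<subset> D. c' D)"
    unfolding up using above by simp
  finally show ?thesis by simp
qed

text \<open>
  At a maximal set where the coefficients differ, the previous lemma applies in both directions.
\<close>

lemma layer_coefficients_unique:
  assumes P: "finite P" "{} \<notin> P"
    and c: "\<And>D. D \<in> P \<Longrightarrow> 0 \<le> c D" "subset.chain P {D \<in> P. c D \<noteq> 0}"
    and c': "\<And>D. D \<in> P \<Longrightarrow> 0 \<le> c' D" "subset.chain P {D \<in> P. c' D \<noteq> 0}"
    and eq: "layer_sum P c = layer_sum P c'"
  shows "B \<in> P \<Longrightarrow> c B = c' B"
proof (rule ccontr)
  assume "B \<in> P" "c B \<noteq> c' B"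
  then have "finite {D \<in> P. c D \<noteq> c' D}" "{D \<in> P. c D \<noteq> c' D} \<noteq> {}" using P by auto
  then obtain M where M: "M \<in> P" "c M \<noteq> c' M"
    and max: "\<And>D. D \<in> P \<Longrightarrow> c D \<noteq> c' D \<Longrightarrow> M \<subseteq> D \<Longrightarrow> M = D"
    using finite_has_maximal[of "{D \<in> P. c D \<noteq> c' D}"] by auto
  have above: "c D = c' D" if "D \<in> P" "M \<subset> D" for D
    using max that by blast
  have "M \<noteq> {}" using M P by blast
  have "c' M \<le> c M"
    by (rule layer_coefficient_le[OF P(1) c c'(1) eq M(1) \<open>M \<noteq> {}\<close>]) (use above in auto)
  moreover have "c M \<le> c' M"
    by (rule layer_coefficient_le[OF P(1) c' c(1) eq[symmetric] M(1) \<open>M \<noteq> {}\<close>]) (use above in auto)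
  ultimately show False using M(2) by simp
qed

text \<open>
  Induction on the size of the support \<open>T\<close>: subtracting the least positive value \<open>m\<close> on \<open>T\<close>
  leaves a function with smaller support whose superlevel sets are again superlevel sets of \<open>x\<close>,
  and \<open>T\<close> with coefficient \<open>m\<close> is put on top of its chain.
\<close>

lemma layer_decomposition:
  fixes x :: "'a \<Rightarrow> real"
  assumes "finite P" "finite {v. x v \<noteq> 0}" "\<And>v. 0 \<le> x v"
    and "\<And>t. 0 < t \<Longrightarrow> {v. t \<le> x v} \<noteq> {} \<Longrightarrow> {v. t \<le> x v} \<in> P"
  obtains c where "\<And>B. 0 \<le> c B" "subset.chain P {B. c B \<noteq> 0}" "layer_sum P c = x"
proof -
  have "\<exists>c. (\<forall>B. 0 \<le> c B) \<and> subset.chain P {B. c B \<noteq> 0} \<and> layer_sum P c = x \<and>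
     (\<forall>B. c B \<noteq> 0 \<longrightarrow> B \<subseteq> {v. x v \<noteq> 0})"
    using assms(2-)
  proof (induction "card {v. x v \<noteq> 0}" arbitrary: x rule: less_induct)
    case less
    define T where "T = {v. x v \<noteq> 0}"
    show ?case
    proof (cases "T = {}")
      case True
      then have "x = (\<lambda>_. 0)" by (auto simp: T_def)
      then show ?thesis
        by (intro exI[of _ "\<lambda>_. 0"]) (auto simp: layer_sum_def subset_chain_def)
    next
      case False
      define m where "m = Min (x ` T)"
      have finT: "finite T" using less.prems by (simp add: T_def)
      have "m \<in> x ` T" unfolding m_def using finT False by (intro Min_in) auto
      then obtain w where w: "w \<in> T" "x w = m" by auto
      have m_le: "m \<le> x v" if "v \<in> T" for v using that finT by (simp add: m_def)
      have m_pos: "0 < m" using w less.prems(2)[of w] by (auto simp: T_def)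
      have T_level: "T = {v. m \<le> x v}" using m_le m_pos by (auto simp: T_def)
      then have "T \<in> P" using less.prems(3)[OF m_pos] False by simp
      define y where "y v = (if v \<in> T then x v - m else 0)" for v
      have supp_y: "{v. y v \<noteq> 0} \<subset> T" using w by (auto simp: y_def)
      have level_y: "{v. t \<le> y v} = {v. t + m \<le> x v}" if "0 < t" for t
        using that m_pos by (auto simp: y_def T_def)
      have "\<exists>c. (\<forall>B. 0 \<le> c B) \<and> subset.chain P {B. c B \<noteq> 0} \<and> layer_sum P c = y \<and>
         (\<forall>B. c B \<noteq> 0 \<longrightarrow> B \<subseteq> {v. y v \<noteq> 0})"
      proof (rule less.hyps)
        show "card {v. y v \<noteq> 0} < card {v. x v \<noteq> 0}"
          using supp_y finT by (simp add: psubset_card_mono flip: T_def)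
        show "finite {v. y v \<noteq> 0}" using supp_y finT by (meson finite_subset psubset_imp_subset)
        show "0 \<le> y v" for v using m_le by (simp add: y_def)
        show "{v. t \<le> y v} \<in> P" if "0 < t" "{v. t \<le> y v} \<noteq> {}" for t
          using that less.prems(3)[of "t + m"] m_pos by (simp add: level_y)
      qed
      then obtain c where c: "\<And>B. 0 \<le> c B" "subset.chain P {B. c B \<noteq> 0}" "layer_sum P c = y"
        and sub: "\<And>B. c B \<noteq> 0 \<Longrightarrow> B \<subseteq> {v. y v \<noteq> 0}" by auto
      have "c T = 0" using sub[of T] supp_y by blast
      define d where "d = c(T := m)"
      have "layer_sum P d v = x v" for v
      proof (cases "v \<in> T")
        case True
        then have ins: "{B. B \<in> P \<and> v \<in> B} = insert T {B. B \<in> P \<and> v \<in> B \<and> B \<noteq> T}"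
          using \<open>T \<in> P\<close> by auto
        have "layer_sum P d v = m + (\<Sum>B | B \<in> P \<and> v \<in> B \<and> B \<noteq> T. c B)"
          unfolding layer_sum_def ins using assms(1) by (subst sum.insert) (auto simp: d_def)
        also have "(\<Sum>B | B \<in> P \<and> v \<in> B \<and> B \<noteq> T. c B) = layer_sum P c v"
          unfolding layer_sum_def ins using assms(1) \<open>c T = 0\<close> by (subst sum.insert) auto
        finally show ?thesis using True by (simp add: c(3) y_def)
      next
        case False
        then have "layer_sum P d v = layer_sum P c v"
          unfolding layer_sum_def by (intro sum.cong) (auto simp: d_def)
        then show ?thesis using False by (simp add: c(3) y_def) (simp add: T_def)
      qed
      moreover have "subset.chain P {B. d B \<noteq> 0}"
      proof -
        have "{B. d B \<noteq> 0} = insert T {B. c B \<noteq> 0}" using m_pos by (auto simp: d_def)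
        moreover have "B \<subseteq> T" if "c B \<noteq> 0" for B using sub[OF that] supp_y by blast
        ultimately show ?thesis using c(2) \<open>T \<in> P\<close> by (auto simp: subset_chain_insert)
      qed
      moreover have "0 \<le> d B" for B using c(1) m_pos by (simp add: d_def)
      moreover have "B \<subseteq> T" if "d B \<noteq> 0" for B
        using sub[of B] supp_y that by (cases "B = T") (auto simp: d_def)
      ultimately show ?thesis unfolding T_def by blast
    qed
  qed
  then show ?thesis using that by blast
qed

section \<open>Level sets of saturated points\<close>

lemma saturated_level_set:
  assumes "finite (\<Union>F)" "x \<in> saturated_points F" "0 < t" "{v. t \<le> x v} \<noteq> {}"
  shows "{v. t \<le> x v} \<in> facet_intersections F"
proof -
  have x: "x \<in> points (facet_complex F)" "saturation F x = x"
    using assms(2) by (auto simp: saturated_points_def)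
  obtain S where S: "S \<in> F" "{v. x v \<noteq> 0} \<subseteq> S"
    using x(1) by (auto simp: points_facet_complex_iff[OF assms(1)])
  have "{v. t \<le> x v} \<subseteq> {v. x v \<noteq> 0}" using assms(3) by auto
  with S have sub: "{v. t \<le> x v} \<subseteq> S" by blast
  have "\<exists>S\<in>F. {v. t \<le> x v} \<subseteq> S \<and> v \<notin> S" if v: "\<not> t \<le> x v" for v
  proof (cases "v \<in> \<Union>F")
    case True
    then obtain S' where S': "S' \<in> insert {} F" "v \<notin> S'" "\<And>w. w \<in> \<Union>F - S' \<Longrightarrow> \<not> t \<le> x w"
      using v le_saturation_iff[OF assms(1) True, of t x] x(2) by auto
    then have "{v. t \<le> x v} \<subseteq> S'" using sub S(1) by blast
    with S' assms(4) show ?thesis by auto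
  next
    case False
    then show ?thesis using S(1) sub by blast
  qed
  then show ?thesis
    using assms(4) S(1) sub unfolding facet_intersections_iff by (auto simp: facet_complex_def)
qed

text \<open>
  Let \<open>U\<close> be the family of the chain members that miss \<open>v\<close>. Off \<open>\<Union>U\<close> the sum is at most its
  value at \<open>v\<close>, because each member that meets the complement of \<open>\<Union>U\<close> contains \<open>v\<close>. Since
  \<open>\<Union>U\<close> is empty or itself a closed face, some admissible \<open>S\<close> covers it and misses \<open>v\<close>, and
  this \<open>S\<close> bounds the saturation at \<open>v\<close>.
\<close>

lemma saturation_layer_sum:
  assumes fin: "finite (\<Union>F)" and P: "P = facet_intersections F"
    and c: "\<And>B. B \<in> P \<Longrightarrow> 0 \<le> c B" "subset.chain P {B \<in> P. c B \<noteq> 0}"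
  shows "saturation F (layer_sum P c) = layer_sum P c"
proof
  fix v
  let ?x = "layer_sum P c"
  have finP: "finite P" using finite_facet_intersections[OF fin] P by simp
  show "saturation F ?x v = ?x v"
  proof (cases "v \<in> \<Union>F")
    case True
    have "saturation F ?x v \<le> ?x v"
    proof (rule ccontr)
      assume "\<not> ?thesis"
      then have less: "?x v < saturation F ?x v" by simp
      define U where "U = {B \<in> P. c B \<noteq> 0 \<and> v \<notin> B}"
      have below: "?x w \<le> ?x v" if "w \<notin> \<Union>U" for w
      proof -
        have "?x w = (\<Sum>B | B \<in> P \<and> w \<in> B \<and> c B \<noteq> 0. c B)"
          unfolding layer_sum_def using finP by (intro sum.mono_neutral_right) auto
        also have "\<dots> \<le> ?x v"
          unfolding layer_sum_def using finP c(1) that by (intro sum_mono2) (auto simp: U_def)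
        finally show ?thesis .
      qed
      obtain S where S: "S \<in> insert {} F" "v \<notin> S" "\<Union>U \<subseteq> S"
      proof (cases "U = {}")
        case True
        then show ?thesis by (intro that[of "{}"]) simp_all
      next
        case False
        have "subset.chain P U" using c(2) by (auto simp: U_def subset_chain_def)
        then have "\<Union>U \<in> U" using finP False by (intro Union_in_chain) (auto simp: U_def)
        then have "\<Union>U \<in> facet_intersections F" "v \<notin> \<Union>U" unfolding P[symmetric] by (simp_all add: U_def)
        then obtain S where "S \<in> F" "\<Union>U \<subseteq> S" "v \<notin> S" by (rule facet_intersections_separate)
        then show ?thesis by (intro that[of S]) simp_all
      qed
      obtain w where w: "w \<in> \<Union>F - S" "saturation F ?x v \<le> ?x w"
        by (rule saturation_witness[OF fin True S(1,2)])
      have "w \<notin> \<Union>U" using w(1) S(3) by blast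
      then have "?x w \<le> ?x v" by (rule below)
      with w(2) less show False by linarith
    qed
    then show ?thesis using le_saturation[OF fin True] by (simp add: antisym)
  next
    case False
    have "P \<subseteq> Pow (\<Union>F)"
      unfolding P using facet_intersections_subset facet_complex_subset_Pow by (rule subset_trans)
    with False have none: "{B. B \<in> P \<and> v \<in> B} = {}" by blast
    show ?thesis unfolding saturation_def layer_sum_def none if_not_P[OF False] by simp
  qed
qed

lemma sum_layer_sum:
  assumes "finite V" "finite P" "\<And>B. B \<in> P \<Longrightarrow> B \<subseteq> V"
  shows "sum (layer_sum P c) V = (\<Sum>B\<in>P. real (card B) * c B)"
proof -
  have "sum (layer_sum P c) V = (\<Sum>B\<in>P. \<Sum>v\<in>{v \<in> V. v \<in> B}. c B)"
    unfolding layer_sum_def using assms(1,2) sum.swap_restrict[of V P "\<lambda>v B. c B" "\<lambda>v B. v \<in> B"]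
    by simp
  also have "\<dots> = (\<Sum>B\<in>P. real (card B) * c B)"
  proof (rule sum.cong[OF refl])
    fix B assume "B \<in> P"
    then have "{v \<in> V. v \<in> B} = B" using assms(3) by blast
    then show "(\<Sum>v\<in>{v \<in> V. v \<in> B}. c B) = real (card B) * c B" by simp
  qed
  finally show ?thesis .
qed

section \<open>The order complex of the intersection poset\<close>

text \<open>
  The injection \<open>e\<close> relabels the vertices of the order complex, which are sets, for instance by
  natural numbers.
\<close>

definition order_complex_image :: "('a set \<Rightarrow> 'b) \<Rightarrow> 'a set set \<Rightarrow> 'b set set" where
  "order_complex_image e P = (\<lambda>C. e ` C) ` {C. C \<noteq> {} \<and> subset.chain P C}"

lemma finite_order_complex_image: "finite P \<Longrightarrow> finite (order_complex_image e P)"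
proof -
  assume "finite P"
  moreover have "{C. C \<noteq> {} \<and> subset.chain P C} \<subseteq> Pow P" by (auto simp: subset_chain_def)
  ultimately show ?thesis
    unfolding order_complex_image_def by (meson finite_Pow_iff finite_imageI finite_subset)
qed

lemma abstract_complex_order_complex_image:
  assumes "finite P" shows "abstract_complex (order_complex_image e P)"
  unfolding abstract_complex_def
proof (intro conjI ballI allI impI)
  fix \<sigma> assume "\<sigma> \<in> order_complex_image e P"
  then obtain C where C: "\<sigma> = e ` C" "C \<noteq> {}" "subset.chain P C"
    unfolding order_complex_image_def by blast
  show "finite \<sigma>"
    unfolding C(1) using C(3) assms by (meson finite_imageI finite_subset subset_chain_def)
  show "\<sigma> \<noteq> {}" using C(1,2) by simp
  fix \<tau> assume \<tau>: "\<tau> \<subseteq> \<sigma> \<and> \<tau> \<noteq> {}"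
  then have eq: "\<tau> = e ` {B \<in> C. e B \<in> \<tau>}" using C(1) by auto
  have "{B \<in> C. e B \<in> \<tau>} \<noteq> {}" using eq \<tau> by blast
  moreover have "subset.chain P {B \<in> C. e B \<in> \<tau>}" using C(3) by (auto simp: subset_chain_def)
  ultimately show "\<tau> \<in> order_complex_image e P"
    by (subst eq) (simp add: order_complex_image_def)
qed

lemma complex_dim_order_complex_image_le:
  assumes "finite P" "\<And>C. C \<noteq> {} \<Longrightarrow> subset.chain P C \<Longrightarrow> int (card C) - 1 \<le> d" "-1 \<le> d"
  shows "complex_dim (order_complex_image e P) \<le> d"
proof -
  have "int (card (e ` C)) - 1 \<le> d" if "C \<noteq> {}" "subset.chain P C" for C
  proof -
    have "finite C" using that assms(1) by (auto simp: subset_chain_def intro: finite_subset)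
    then have "card (e ` C) \<le> card C" by (rule card_image_le)
    then show ?thesis using assms(2)[OF that] by linarith
  qed
  then show ?thesis
    using finite_order_complex_image[OF assms(1), of e] assms(3)
    unfolding complex_dim_def by (subst Max_le_iff) (auto simp: order_complex_image_def)
qed

lemma order_complex_image_support_iff:
  assumes e: "inj_on e P"
  shows "{i. y i \<noteq> 0} \<in> order_complex_image e P \<longleftrightarrow>
    {i. y i \<noteq> (0::real)} \<subseteq> e ` P \<and> {i. y i \<noteq> 0} \<noteq> {} \<and> subset.chain P {B \<in> P. y (e B) \<noteq> 0}"
    (is "?l \<longleftrightarrow> ?r")
proof
  assume ?l
  then obtain C where C: "{i. y i \<noteq> 0} = e ` C" "C \<noteq> {}" "subset.chain P C"
    by (auto simp: order_complex_image_def)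
  have "{B \<in> P. y (e B) \<noteq> 0} = {B \<in> P. e B \<in> {i. y i \<noteq> 0}}" by simp
  also have "\<dots> = {B \<in> P. e B \<in> e ` C}" by (simp only: C(1))
  also have "\<dots> = C" using C(3) e by (auto simp: subset_chain_def inj_on_def)
  finally show ?r using C by (auto simp: subset_chain_def)
next
  assume r: ?r
  then have "{i. y i \<noteq> 0} = e ` {B \<in> P. y (e B) \<noteq> 0}" by auto
  with r show ?l unfolding order_complex_image_def by (metis (mono_tags, lifting) image_eqI image_is_empty mem_Collect_eq)
qed

text \<open>
  Each closed simplex is a closed subset of a cube, and the cube is compact by Tychonoff's theorem.
\<close>

lemma compact_points:
  assumes "finite K" "abstract_complex K"
  shows "compact (points K)"
proof -
  have finite_face: "finite \<sigma>" if "\<sigma> \<in> K" for \<sigma>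
    using assms(2) that by (simp add: abstract_complex_def)
  define face where "face \<sigma> = {x. (\<forall>v. 0 \<le> x v) \<and> (\<forall>v\<in>-\<sigma>. x v = 0) \<and> sum x \<sigma> = (1::real)}" for \<sigma> :: "'a set"
  have "points K = (\<Union>\<sigma>\<in>K. face \<sigma>)"
  proof (intro equalityI subsetI)
    fix x assume "x \<in> points K"
    then show "x \<in> (\<Union>\<sigma>\<in>K. face \<sigma>)"
      by (intro UN_I[of "{v. x v \<noteq> 0}"]) (auto simp: points_def face_def)
  next
    fix x assume "x \<in> (\<Union>\<sigma>\<in>K. face \<sigma>)"
    then obtain \<sigma> where \<sigma>: "\<sigma> \<in> K" "x \<in> face \<sigma>" by blast
    then have sub: "{v. x v \<noteq> 0} \<subseteq> \<sigma>" by (auto simp: face_def)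
    then have sum: "(\<Sum>v | x v \<noteq> 0. x v) = 1"
      using sum_support[OF finite_face[OF \<sigma>(1)] sub] \<sigma>(2) by (simp add: face_def)
    then have "{v. x v \<noteq> 0} \<noteq> {}" by force
    then have "{v. x v \<noteq> 0} \<in> K" using \<sigma>(1) sub assms(2) unfolding abstract_complex_def by blast
    with sum \<sigma>(2) show "x \<in> points K" by (simp add: points_def face_def)
  qed
  moreover have "compact (face \<sigma>)" if "\<sigma> \<in> K" for \<sigma>
  proof -
    have fin: "finite \<sigma>" using that by (rule finite_face)
    have "compact (PiE UNIV (\<lambda>_::'a. {0..1::real}))"
      unfolding compactin_euclidean_iff[symmetric] euclidean_product_topology[symmetric]
      by (subst compactin_PiE) auto
    moreover have "closed (face \<sigma>)"
    proof -
      have eq: "face \<sigma> = (\<Inter>v. {x. 0 \<le> x v}) \<inter> (\<Inter>v\<in>-\<sigma>. {x. x v = 0}) \<inter> {x. sum x \<sigma> = 1}"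
        by (auto simp: face_def)
      show ?thesis unfolding eq
        by (intro closed_Int closed_INT ballI closed_Collect_le closed_Collect_eq
            continuous_on_const continuous_on_product_coordinates continuous_on_sum)
    qed
    moreover have "face \<sigma> \<subseteq> PiE UNIV (\<lambda>_::'a. {0..1::real})"
    proof
      fix x assume x: "x \<in> face \<sigma>"
      have "x v \<le> 1" for v
      proof (cases "v \<in> \<sigma>")
        case True
        then have "x v \<le> sum x \<sigma>" using fin x by (intro member_le_sum) (auto simp: face_def)
        then show ?thesis using x by (simp add: face_def)
      qed (use x in \<open>auto simp: face_def\<close>)
      then show "x \<in> PiE UNIV (\<lambda>_::'a. {0..1::real})" using x by (auto simp: face_def)
    qed
    ultimately show ?thesis by (metis compact_Int_closed inf.absorb2)
  qed
  ultimately show ?thesis using assms(1) by auto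
qed

text \<open>
  The vertex of the order complex that belongs to \<open>B\<close> is sent to the barycenter of \<open>B\<close>, that is,
  to \<open>1\<^sub>B / card B\<close>. Existence and uniqueness of the decomposition into superlevel sets make the
  affine extension bijective onto the saturated points, and a continuous bijection from a
  compact space to a Hausdorff space is a homeomorphism.
\<close>

lemma order_complex_realization_homeomorphic:
  fixes e :: "'a set \<Rightarrow> 'b"
  assumes fin: "finite (\<Union>F)" and P: "P = facet_intersections F" and e: "inj_on e P"
  shows "top_of_set (saturated_points F) homeomorphic_space realization (order_complex_image e P)"
proof -
  define L where "L = order_complex_image e P"
  define q where "q y B = y (e B) / real (card B)" for y :: "'b \<Rightarrow> real" and B
  define g where "g y = layer_sum P (q y)" for y :: "'b \<Rightarrow> real"
  have finP: "finite P" using finite_facet_intersections[OF fin] P by simp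
  have P_V: "B \<subseteq> \<Union>F" if "B \<in> P" for B
    using that facet_intersections_subset[of F] facet_complex_subset_Pow[of F] P by blast
  have card_pos: "0 < real (card B)" if "B \<in> P" for B
    using that P facet_intersections_nonempty finite_mem_facet_intersections[OF fin]
    by (auto simp: card_gt_0_iff)
  have L_iff: "{i. y i \<noteq> 0} \<in> L \<longleftrightarrow>
    {i. y i \<noteq> 0} \<subseteq> e ` P \<and> {i. y i \<noteq> 0} \<noteq> {} \<and> subset.chain P {B \<in> P. y (e B) \<noteq> 0}"
    for y :: "'b \<Rightarrow> real"
    unfolding L_def by (rule order_complex_image_support_iff[OF e])
  have q_supp: "{B \<in> P. q y B \<noteq> 0} = {B \<in> P. y (e B) \<noteq> 0}" for y :: "'b \<Rightarrow> real"
    using card_pos by (force simp: q_def)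
  have q_nonneg: "0 \<le> q y B" if "y \<in> points L" for y B
    using that by (simp add: q_def points_def)
  have sum_y: "(\<Sum>i | y i \<noteq> 0. y i) = (\<Sum>B\<in>P. y (e B))"
    if "{i. y i \<noteq> 0} \<subseteq> e ` P" for y :: "'b \<Rightarrow> real"
    using sum_support[OF finite_imageI[OF finP] that] by (simp add: sum.reindex[OF e])
  have g_mem: "g y \<in> saturated_points F" if y: "y \<in> points L" for y
  proof -
    have sub: "{i. y i \<noteq> 0} \<subseteq> e ` P" and ne: "{i. y i \<noteq> 0} \<noteq> {}"
      and ch: "subset.chain P {B \<in> P. y (e B) \<noteq> 0}" and one: "(\<Sum>B\<in>P. y (e B)) = 1"
      using y L_iff[of y] sum_y[of y] by (auto simp: points_def)
    have "saturation F (g y) = g y"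
      unfolding g_def using q_nonneg[OF y] ch
      by (intro saturation_layer_sum[OF fin P]) (simp_all add: q_supp)
    moreover have "g y \<in> points (facet_complex F)"
      unfolding points_facet_complex_iff[OF fin]
    proof (intro conjI allI)
      show "0 \<le> g y v" for v unfolding g_def using q_nonneg[OF y] by (rule layer_sum_nonneg)
      have "{B \<in> P. y (e B) \<noteq> 0} \<noteq> {}" using sub ne by blast
      then have "\<Union>{B \<in> P. y (e B) \<noteq> 0} \<in> {B \<in> P. y (e B) \<noteq> 0}"
        using finP ch by (intro Union_in_chain) auto
      moreover have "{v. g y v \<noteq> 0} = \<Union>{B \<in> P. y (e B) \<noteq> 0}"
        unfolding g_def q_supp[symmetric] using q_nonneg[OF y] by (rule layer_sum_support[OF finP])
      ultimately show "\<exists>S\<in>F. {v. g y v \<noteq> 0} \<subseteq> S"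
        using facet_intersections_subset[of F] by (auto simp: facet_complex_def P)
      have "sum (g y) (\<Union>F) = (\<Sum>B\<in>P. real (card B) * q y B)"
        unfolding g_def by (rule sum_layer_sum[OF fin finP P_V])
      also have "\<dots> = (\<Sum>B\<in>P. y (e B))"
        using card_pos by (intro sum.cong) (force simp: q_def)+
      finally show "sum (g y) (\<Union>F) = 1" using one by simp
    qed
    ultimately show ?thesis by (simp add: saturated_points_def)
  qed
  have "continuous_on (points L) g"
  proof (rule continuous_on_coordinatewise_then_product)
    show "continuous_on (points L) (\<lambda>y. g y v)" for v
      unfolding g_def layer_sum_def q_def using card_pos
      by (intro continuous_on_sum continuous_on_divide continuous_on_const
          continuous_on_subset[OF continuous_on_product_coordinates]) force+
  qed
  moreover have "inj_on g (points L)"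
  proof (rule inj_onI)
    fix y z assume y: "y \<in> points L" and z: "z \<in> points L" and eq: "g y = g z"
    have "{} \<notin> P" using facet_intersections_nonempty[of _ F] P by blast
    have chain: "subset.chain P {B \<in> P. q u B \<noteq> 0}" if "u \<in> points L" for u
      using that L_iff[of u] by (simp add: points_def q_supp)
    have q_eq: "q y B = q z B" if "B \<in> P" for B
      using q_nonneg[OF y] chain[OF y] q_nonneg[OF z] chain[OF z] eq that
      unfolding g_def by (intro layer_coefficients_unique[OF finP \<open>{} \<notin> P\<close>])
    have "y (e B) = z (e B)" if "B \<in> P" for B
      using q_eq[OF that] card_pos[OF that] by (simp add: q_def)
    moreover have zero: "u i = 0" if "u \<in> points L" "i \<notin> e ` P" for u i
    proof -
      have "{i. u i \<noteq> 0} \<in> L" using that(1) by (simp add: points_def)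
      then have "{i. u i \<noteq> 0} \<subseteq> e ` P" by (simp only: L_iff)
      then show ?thesis using that(2) by blast
    qed
    ultimately have "y i = z i" for i
      using zero[OF y] zero[OF z] by (cases "i \<in> e ` P") auto
    then show "y = z" by (rule ext)
  qed
  moreover have "g ` points L = saturated_points F"
  proof (intro equalityI subsetI)
    fix x assume x: "x \<in> saturated_points F"
    then have "x \<in> points (facet_complex F)" by (simp add: saturated_points_def)
    then have xK: "\<And>v. 0 \<le> x v" "sum x (\<Union>F) = 1" "\<exists>S\<in>F. {v. x v \<noteq> 0} \<subseteq> S"
      by (simp_all add: points_facet_complex_iff[OF fin])
    have supp: "finite {v. x v \<noteq> 0}" using xK(3) fin by (meson Union_upper finite_subset)
    have level: "{v. t \<le> x v} \<in> P" if "0 < t" "{v. t \<le> x v} \<noteq> {}" for t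
      unfolding P using fin x that by (rule saturated_level_set)
    obtain c where c: "\<And>B. 0 \<le> c B" "subset.chain P {B. c B \<noteq> 0}" "layer_sum P c = x"
      using layer_decomposition[OF finP supp xK(1) level] by blast
    define y where "y i = (if i \<in> e ` P then real (card (inv_into P e i)) * c (inv_into P e i) else 0)" for i
    have y_e: "y (e B) = real (card B) * c B" if "B \<in> P" for B
      using that by (simp add: y_def inv_into_f_f[OF e])
    have "q y B = c B" if "B \<in> P" for B
      using card_pos[OF that] by (simp add: q_def y_e[OF that])
    then have "g y = x"
      unfolding g_def c(3)[symmetric] layer_sum_def by (intro ext sum.cong) simp_all
    moreover have "y \<in> points L"
    proof -
      have sub: "{i. y i \<noteq> 0} \<subseteq> e ` P" by (auto simp: y_def)
      have one: "(\<Sum>i | y i \<noteq> 0. y i) = 1"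
        using sum_y[OF sub] xK(2) sum_layer_sum[OF fin finP P_V, of c] by (simp add: y_e c(3))
      then have ne: "{i. y i \<noteq> 0} \<noteq> {}" by force
      have "{B \<in> P. y (e B) \<noteq> 0} = {B. c B \<noteq> 0}"
      proof -
        have "B \<in> P" if "c B \<noteq> 0" for B using c(2) that by (auto simp: subset_chain_def)
        moreover have "y (e B) \<noteq> 0 \<longleftrightarrow> c B \<noteq> 0" if "B \<in> P" for B
          using card_pos[OF that] by (simp add: y_e[OF that])
        ultimately show ?thesis by blast
      qed
      then have "{i. y i \<noteq> 0} \<in> L" using sub ne c(2) by (simp add: L_iff)
      moreover have "0 \<le> y i" for i using c(1) by (simp add: y_def)
      ultimately show ?thesis using one by (simp add: points_def)
    qed
    ultimately show "x \<in> g ` points L" by blast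
  qed (use g_mem in blast)
  moreover have "compact (points L)"
    unfolding L_def
    by (intro compact_points finite_order_complex_image abstract_complex_order_complex_image finP)
  moreover have hausdorff: "Hausdorff_space (top_of_set (saturated_points F))"
    unfolding euclidean_product_topology[symmetric]
    by (intro Hausdorff_space_subtopology) (simp add: Hausdorff_space_product_topology)
  ultimately have "homeomorphic_map (top_of_set (points L)) (top_of_set (saturated_points F)) g"
    using g_mem hausdorff
    by (intro continuous_imp_homeomorphic_map) (simp_all add: compact_space_subtopology Pi_iff)
  then show ?thesis
    unfolding realization_eq_top_of_set L_def
    using homeomorphic_map_imp_homeomorphic_space homeomorphic_space_sym by blast
qed

section \<open>Chains of intersections of out-neighborhoods\<close>

lemma (in pair_fin_digraph) contains_copy_complete_bipartite:
  assumes A: "A \<subseteq> pverts G" "card A = m" and B: "B \<subseteq> pverts G" "card B = n"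
    and AB: "A \<inter> B = {}" "A \<times> B \<subseteq> parcs G"
  shows "contains_copy G (complete_bipartite_digraph m n)"
proof -
  have "finite A" "finite B" using A B pair_finite_verts by (auto intro: finite_subset)
  then obtain a b where a: "bij_betw a {1..m} A" and b: "bij_betw b {1..n} B"
    using A(2) B(2) by (metis ex_bij_betw_nat_finite_1)
  define f where "f = case_sum a b"
  define H where "H = \<lparr>pverts = A \<union> B, parcs = A \<times> B\<rparr>"
  define K where "K = complete_bipartite_digraph m n"
  define iso where "iso = \<lparr>iso_verts = f, iso_arcs = map_prod f f, iso_head = snd, iso_tail = fst\<rparr>"
  have "inj_on f (Inl ` {1..m})" "inj_on f (Inr ` {1..n})"
    using a b by (auto intro!: inj_on_imageI simp: f_def comp_def bij_betw_def)
  moreover have f_img: "f ` Inl ` {1..m} = A" "f ` Inr ` {1..n} = B"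
    using a b by (simp_all add: f_def image_image bij_betw_def)
  ultimately have inj: "inj_on f (pverts K)"
    using AB(1) unfolding K_def complete_bipartite_digraph_def by (simp add: inj_on_Un) blast
  have V: "f ` pverts K = pverts H"
    unfolding K_def complete_bipartite_digraph_def H_def by (simp add: image_Un f_img del: One_nat_def)
  have arcs_K: "parcs K = Inl ` {1..m} \<times> Inr ` {1..n}"
    by (auto simp: K_def complete_bipartite_digraph_def)
  have E: "map_prod f f ` parcs K = parcs H"
    unfolding arcs_K H_def by (simp add: map_prod_surj_on[OF f_img] del: One_nat_def)
  have wf_K: "wf_digraph (with_proj K)"
    by unfold_locales (auto simp: K_def complete_bipartite_digraph_def)
  have "inj_on (map_prod f f) (parcs K)"
    using inj by (intro inj_on_subset[OF map_prod_inj_on[OF inj inj]])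
      (auto simp: K_def complete_bipartite_digraph_def)
  then have "pre_digraph.digraph_isomorphism (with_proj K) iso"
    unfolding pre_digraph.digraph_isomorphism_def using wf_K inj by (auto simp: iso_def)
  moreover have "with_proj H = app_iso iso (with_proj K)"
    using V E by (simp add: app_iso_def iso_def with_proj_def)
  ultimately have "digraph_iso (with_proj K) (with_proj H)"
    unfolding digraph_iso_def by blast
  moreover have "subgraph (with_proj H) (with_proj G)"
    unfolding subgraph_def compatible_def
  proof (intro conjI)
    show "wf_digraph (with_proj H)" by unfold_locales (auto simp: H_def)
    show "wf_digraph (with_proj G)" by unfold_locales
  qed (use A B AB in \<open>auto simp: H_def\<close>)
  ultimately show ?thesis unfolding contains_copy_def K_def by blast
qed

lemma (in pair_fin_digraph) no_complete_bipartite_product: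
  assumes "\<not> contains_copy G (complete_bipartite_digraph m n)" "no_overlapping_product m n G"
    and "A \<subseteq> pverts G" "B \<subseteq> pverts G" "A \<times> B \<subseteq> parcs G" "m \<le> card A"
  shows "card B < n"
proof (rule ccontr)
  assume "\<not> card B < n"
  then obtain B' where B': "B' \<subseteq> B" "card B' = n" by (meson not_less obtain_subset_with_card_n)
  obtain A' where A': "A' \<subseteq> A" "card A' = m" using assms(6) by (meson obtain_subset_with_card_n)
  have sub: "A' \<subseteq> pverts G" "B' \<subseteq> pverts G" "A' \<times> B' \<subseteq> parcs G" using A' B' assms by auto
  then have "A' \<inter> B' = {}" using A' B' assms(2) by (simp add: no_overlapping_product_def)
  then show False
    using contains_copy_complete_bipartite[OF sub(1) A'(2) sub(2) B'(2) _ sub(3)] assms(1) by blast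
qed

definition common_in_neighbors :: "'a pair_pre_digraph \<Rightarrow> 'a set \<Rightarrow> 'a set" where
  "common_in_neighbors G B = {u \<in> pverts G. B \<subseteq> out_neighborhood G u}"

text \<open>
  An intersection of out-neighborhoods is recovered from its common in-neighbors as the
  intersection of their out-neighborhoods.
\<close>

lemma common_in_neighbors_inject:
  assumes "B \<in> facet_intersections (out_neighborhood G ` pverts G)"
    and "D \<in> facet_intersections (out_neighborhood G ` pverts G)"
    and "common_in_neighbors G B = common_in_neighbors G D"
  shows "B = D"
proof -
  have le: "Y \<subseteq> X"
    if X: "X \<in> facet_intersections (out_neighborhood G ` pverts G)"
      and eq: "common_in_neighbors G X = common_in_neighbors G Y" for X Y
  proof
    fix v assume "v \<in> Y"
    show "v \<in> X"
    proof (rule ccontr)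
      assume "v \<notin> X"
      with X obtain S where "S \<in> out_neighborhood G ` pverts G" "X \<subseteq> S" "v \<notin> S"
        by (rule facet_intersections_separate)
      then obtain u where "u \<in> common_in_neighbors G X" "v \<notin> out_neighborhood G u"
        by (auto simp: common_in_neighbors_def)
      with eq \<open>v \<in> Y\<close> show False by (auto simp: common_in_neighbors_def)
    qed
  qed
  show ?thesis
    using le[OF assms(1) assms(3)] le[OF assms(2) assms(3)[symmetric]] by (rule subset_antisym[rotated])
qed

text \<open>
  The chain is split by size at \<open>n\<close>. On the part below \<open>n\<close> the size is injective with values
  in \<open>{1..<n}\<close>. On the rest the number of common in-neighbors is injective, and its values
  lie in \<open>{1..<m}\<close>, as otherwise the digraph would contain the complete bipartite product.
\<close>

lemma (in pair_fin_digraph) card_chain_facet_intersections: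
  assumes "1 \<le> m" "1 \<le> n" and no: "\<not> contains_copy G (complete_bipartite_digraph m n)"
    "no_overlapping_product m n G"
    and chain: "subset.chain (facet_intersections (out_neighborhood G ` pverts G)) C"
  shows "card C + 2 \<le> m + n"
proof -
  define P where "P = facet_intersections (out_neighborhood G ` pverts G)"
  define N where "N = common_in_neighbors G"
  have CP: "B \<in> P" if "B \<in> C" for B using chain that by (auto simp: subset_chain_def P_def)
  have comparable: "B \<subseteq> D \<or> D \<subseteq> B" if "B \<in> C" "D \<in> C" for B D
    using chain that by (auto simp: subset_chain_def)
  have finN: "finite (N B)" for B using pair_finite_verts by (simp add: N_def common_in_neighbors_def)
  have P_V: "B \<subseteq> pverts G" and P_ne: "B \<noteq> {}" and N_ne: "N B \<noteq> {}" if "B \<in> P" for B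
    using that unfolding P_def facet_intersections_iff
    by (auto simp: facet_complex_def N_def common_in_neighbors_def out_neighborhood_def)
  have finB: "finite B" if "B \<in> P" for B using P_V[OF that] pair_finite_verts by (rule finite_subset)
  have anti: "N D \<subseteq> N B" if "B \<subseteq> D" for B D using that by (auto simp: N_def common_in_neighbors_def)
  define C1 where "C1 = {B \<in> C. card B < n}"
  define C2 where "C2 = {B \<in> C. n \<le> card B}"
  have "card C1 \<le> card {1..<n}"
  proof (rule card_inj_on_le)
    show "inj_on card C1"
      using comparable CP finB unfolding C1_def by (intro inj_onI) (metis (lifting) card_subset_eq mem_Collect_eq)
    show "card ` C1 \<subseteq> {1..<n}"
      using CP finB P_ne unfolding C1_def by (force simp: Suc_le_eq card_gt_0_iff)
  qed simp
  moreover have "card C2 \<le> card {1..<m}"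
  proof (rule card_inj_on_le)
    show "inj_on (\<lambda>B. card (N B)) C2"
    proof (rule inj_onI)
      fix B D assume BD: "B \<in> C2" "D \<in> C2" and "card (N B) = card (N D)"
      then have "N B = N D"
        using comparable[of B D] anti[of B D] anti[of D B] finN
        unfolding C2_def by (metis (lifting) card_subset_eq mem_Collect_eq)
      then show "B = D" using BD CP common_in_neighbors_inject[of B G D] by (auto simp: C2_def P_def N_def)
    qed
    show "(\<lambda>B. card (N B)) ` C2 \<subseteq> {1..<m}"
    proof safe
      fix B assume "B \<in> C2"
      then have B: "B \<in> P" "n \<le> card B" using CP by (auto simp: C2_def)
      have "\<not> m \<le> card (N B)"
        using no_complete_bipartite_product[OF no, of "N B" B] P_V[OF B(1)] B(2)
        by (auto simp: N_def common_in_neighbors_def out_neighborhood_def)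
      moreover have "card (N B) \<noteq> 0" using N_ne[OF B(1)] finN by simp
      ultimately show "card (N B) \<in> {1..<m}" by auto
    qed
  qed simp
  moreover have "card C \<le> card C1 + card C2"
  proof -
    have "C = C1 \<union> C2" by (auto simp: C1_def C2_def)
    then show ?thesis using card_Un_le by blast
  qed
  ultimately show ?thesis using assms(1,2) by simp
qed

theorem proposition4p11:
  fixes G :: "'a pair_pre_digraph" and m n :: nat
  assumes "pair_fin_digraph G"
    and "1 \<le> m" and "1 \<le> n"
    and "\<not> contains_copy G (complete_bipartite_digraph m n)"
    and "no_overlapping_product m n G"
  shows "\<exists>(R :: ('a \<Rightarrow> real) set) (L :: nat set set).
           R strong_deformation_retract_of_space (realization (out_neighborhood_complex G)) \<and>
           finite L \<and> abstract_complex L \<and> complex_dim L \<le> int m + int n - 3 \<and>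
           subtopology (realization (out_neighborhood_complex G)) R
             homeomorphic_space realization L"
proof -
  interpret pair_fin_digraph G by (rule assms(1))
  define F where "F = out_neighborhood G ` pverts G"
  define P where "P = facet_intersections F"
  have K: "out_neighborhood_complex G = facet_complex F"
    by (auto simp: out_neighborhood_complex_def facet_complex_def F_def)
  have fin: "finite (\<Union>F)"
    using pair_finite_verts by (auto simp: F_def out_neighborhood_def)
  have finP: "finite P" unfolding P_def by (rule finite_facet_intersections[OF fin])
  then obtain e :: "'a set \<Rightarrow> nat" where e: "inj_on e P"
    using finite_imp_inj_to_nat_seg by blast
  have "int (card C) - 1 \<le> int m + int n - 3" if "subset.chain P C" for C
    using card_chain_facet_intersections[OF assms(2-5), of C] that by (simp add: P_def F_def)
  then have dim: "complex_dim (order_complex_image e P) \<le> int m + int n - 3"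
    using assms(2,3) by (intro complex_dim_order_complex_image_le[OF finP]) auto
  have sub: "subtopology (realization (facet_complex F)) (saturated_points F)
      = top_of_set (saturated_points F)"
    unfolding realization_eq_top_of_set
    by (simp add: subtopology_subtopology saturated_points_def inf_absorb2)
  show ?thesis
    unfolding K
  proof (intro exI conjI)
    show "saturated_points F strong_deformation_retract_of_space realization (facet_complex F)"
      by (rule saturated_points_strong_deformation_retract[OF fin])
    show "finite (order_complex_image e P)" by (rule finite_order_complex_image[OF finP])
    show "abstract_complex (order_complex_image e P)"
      by (rule abstract_complex_order_complex_image[OF finP])
    show "complex_dim (order_complex_image e P) \<le> int m + int n - 3" by (rule dim)
    show "subtopology (realization (facet_complex F)) (saturated_points F)
        homeomorphic_space realization (order_complex_image e P)"
      unfolding sub by (rule order_complex_realization_homeomorphic[OF fin P_def e])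
  qed
qed

end
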